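(* For every integer $n\ge 0$, \[ x\,\mathrm{Bel}_{n,\lambda}^{(1)}(x)=\sum_{m=0}^{n}\frac{1}{m+1}\binom{n}{m}\beta_{n-m,\lambda}\,\mathrm{Bel}_{m+1,\lambda}(x), \] and in particular (taking $x=1$) \[ \mathrm{Bel}_{n,\lambda}^{(1)}=\sum_{m=0}^{n}\frac{1}{m+1}\binom{n}{m}\beta_{n-m,\lambda}\,\mathrm{Bel}_{m+1,\lambda}. \]
   Context: Let $\lambda\in\mathbb{R}$. Set $(x)_{0,\lambda}=1$, $(x)_{n,\lambda}=x(x-\lambda)\cdots(x-(n-1)\lambda)$ for $n\ge1$. The degenerate exponential is the formal power series $e_\lambda^x(t)=\sum_{n\ge0}(x)_{n,\lambda}\frac{t^n}{n!}$ ($=(1+\lambda t)^{x/\lambda}$, and $e^{xt}$ if $\lambda=0$), $e_\lambda(t)=e_\lambda^1(t)$. Degenerate Bell polynomials: $e^{x(e_\lambda(t)-1)}=\sum_{n\ge0}\mathrm{Bel}_{n,\lambda}(x)\frac{t^n}{n!}$, and $\mathrm{Bel}_{n,\lambda}=\mathrm{Bel}_{n,\lambda}(1)$. Carlitz's degenerate Bernoulli numbers $\beta_{n,\lambda}$: $\frac{t}{e_\lambda(t)-1}=\sum_{n\ge0}\beta_{n,\lambda}\frac{t^n}{n!}$. For an integer $p\ge0$, the truncated degenerate Bell polynomials are defined by $\sum_{n\ge0}\mathrm{Bel}^{(p)}_{n,\lambda}(x)\frac{t^n}{n!}=\frac{p!}{x^p(e_\lambda(t)-1)^p}\Big(e^{x(e_\lambda(t)-1)}-\sum_{k=0}^{p-1}\frac{x^k(e_\lambda(t)-1)^k}{k!}\Big)=p!\sum_{k\ge0}\frac{x^k(e_\lambda(t)-1)^k}{(k+p)!}$,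 and $\mathrm{Bel}^{(p)}_{n,\lambda}=\mathrm{Bel}^{(p)}_{n,\lambda}(1)$. *)

theory Defs
  imports Complex_Main "HOL-Computational_Algebra.Formal_Power_Series"
begin

definition degenerate_falling :: "real \<Rightarrow> real \<Rightarrow> nat \<Rightarrow> real" where
  "degenerate_falling l x n = (\<Prod>i<n. x - real i * l)"

definition degenerate_exp :: "real \<Rightarrow> real \<Rightarrow> real fps" where
  "degenerate_exp l x = Abs_fps (\<lambda>n. degenerate_falling l x n / fact n)"

text \<open>
  All polynomials below are given by their values at real \<open>x\<close>. The coefficient of \<open>t ^ n / n!\<close>
  in a power series \<open>F\<close> is \<open>fact n * fps_nth F n\<close>. The series \<open>degenerate_exp l 1 - 1\<close> has
  constant term \<open>0\<close> and linear term \<open>t\<close>, so the compositions and the quotient below are the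
  usual ones.
\<close>

definition degenerate_Bell :: "real \<Rightarrow> nat \<Rightarrow> real \<Rightarrow> real" where
  "degenerate_Bell l n x = fact n * fps_nth (fps_exp x oo (degenerate_exp l 1 - 1)) n"

definition degenerate_Bell_number :: "real \<Rightarrow> nat \<Rightarrow> real" where
  "degenerate_Bell_number l n = degenerate_Bell l n 1"

definition Carlitz_Bernoulli :: "real \<Rightarrow> nat \<Rightarrow> real" where
  "Carlitz_Bernoulli l n = fact n * fps_nth (fps_X / (degenerate_exp l 1 - 1)) n"

text \<open>
  The generating function is \<open>p! * (\<Sum>k. x ^ k * u ^ k / (k + p)!)\<close> at \<open>u = degenerate_exp l 1 - 1\<close>.
  Unlike the quotient form, which is proved equal to it for \<open>x \<noteq> 0\<close> below, the series also makes
  sense at \<open>x = 0\<close>.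
\<close>

definition truncated_Bell_gf :: "nat \<Rightarrow> real \<Rightarrow> real \<Rightarrow> real fps" where
  "truncated_Bell_gf p l x =
     fps_const (fact p) * (Abs_fps (\<lambda>k. x ^ k / fact (k + p)) oo (degenerate_exp l 1 - 1))"

definition truncated_degenerate_Bell :: "nat \<Rightarrow> real \<Rightarrow> nat \<Rightarrow> real \<Rightarrow> real" where
  "truncated_degenerate_Bell p l n x = fact n * fps_nth (truncated_Bell_gf p l x) n"

definition truncated_degenerate_Bell_number :: "nat \<Rightarrow> real \<Rightarrow> nat \<Rightarrow> real" where
  "truncated_degenerate_Bell_number p l n = truncated_degenerate_Bell p l n 1"

lemma degenerate_exp_0 [simp]: "fps_nth (degenerate_exp l x) 0 = 1"
  by (simp add: degenerate_exp_def degenerate_falling_def)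

lemma degenerate_exp_1 [simp]: "fps_nth (degenerate_exp l x) (Suc 0) = x"
  by (simp add: degenerate_exp_def degenerate_falling_def)

lemma truncated_Bell_gf_quotient:
  fixes l x :: real
  assumes "x \<noteq> 0"
  defines "u \<equiv> degenerate_exp l 1 - 1"
  shows "truncated_Bell_gf p l x =
    fps_const (fact p) * ((fps_exp x oo u) - (\<Sum>k<p. fps_const (x ^ k / fact k) * u ^ k))
      / (fps_const (x ^ p) * u ^ p)"
proof -
  have u0: "fps_nth u 0 = 0" and "fps_nth u 1 \<noteq> 0" by (simp_all add: u_def)
  then have "u \<noteq> 0" by auto
  define A where "A = Abs_fps (\<lambda>k. x ^ k / fact (k + p))"
  define B where "B = (\<Sum>k<p. fps_const (x ^ k / fact k) * fps_X ^ k)"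
  have "fps_exp x - B = fps_const (x ^ p) * A * fps_X ^ p"
    by (rule fps_ext)
      (auto simp: A_def B_def fps_sum_nth fps_X_power_nth fps_X_power_mult_right_nth
        fps_mult_left_const_nth mult.assoc if_distrib sum.delta' not_less power_add [symmetric]
        cong: if_cong)
  then have "(fps_exp x - B) oo u = (fps_const (x ^ p) * A * fps_X ^ p) oo u" by simp
  moreover have "B oo u = (\<Sum>k<p. fps_const (x ^ k / fact k) * u ^ k)"
    using u0 by (simp add: B_def fps_compose_sum_distrib fps_compose_mult_distrib
        fps_compose_power[symmetric])
  ultimately have "(fps_exp x oo u) - (\<Sum>k<p. fps_const (x ^ k / fact k) * u ^ k)
      = (A oo u) * (fps_const (x ^ p) * u ^ p)"
    using u0 by (simp add: fps_compose_sub_distrib fps_compose_mult_distrib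
        fps_compose_power[symmetric] mult_ac)
  moreover have "fps_const (x ^ p) * u ^ p \<noteq> 0"
    using \<open>u \<noteq> 0\<close> assms(1) by simp
  ultimately have "fps_const (fact p) *
      ((fps_exp x oo u) - (\<Sum>k<p. fps_const (x ^ k / fact k) * u ^ k)) / (fps_const (x ^ p) * u ^ p)
      = fps_const (fact p) * (A oo u)"
    using nonzero_mult_div_cancel_right [of "fps_const (x ^ p) * u ^ p" "fps_const (fact p) * (A oo u)"]
    by (metis mult.assoc)
  then show ?thesis
    by (simp add: truncated_Bell_gf_def A_def u_def)
qed

end

theory Submission
  imports Defs
begin

text \<open>
  With \<open>u = e\<^sub>\<lambda>(t) - 1\<close> and \<open>E = exp (x u)\<close>, the case \<open>p = 1\<close> of the truncated generating function
  \<open>T\<close> satisfies \<open>E - 1 = x T u\<close>, while \<open>E - 1 = t S\<close> with \<open>S\<close> the shifted series of \<open>E\<close>. Since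
  \<open>t = (t / u) u\<close>, cancelling \<open>u\<close> yields \<open>x T = S (t / u)\<close>; the claim compares coefficients.
\<close>

lemma degenerate_exp_minus_1_nonzero: "degenerate_exp l 1 - 1 \<noteq> 0"
proof
  assume "degenerate_exp l 1 - 1 = 0"
  then have "fps_nth (degenerate_exp l 1 - 1) 1 = 0"
    by (simp only: fps_zero_nth)
  then show False
    by simp
qed

text \<open>The quotient of power series is exact only under divisibility. Here the linear
  coefficient of the divisor is 1, so its \<open>subdegree\<close> is at most that of
  \<open>fps_X\<close>.\<close>

lemma Carlitz_Bernoulli_gf_mult:
  "fps_X / (degenerate_exp l 1 - 1) * (degenerate_exp l 1 - 1) = fps_X"
proof -
  let ?u = "degenerate_exp l 1 - 1"
  have "fps_nth ?u 1 \<noteq> 0"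
    by simp
  then have "subdegree ?u \<le> 1"
    by (rule subdegree_leI)
  moreover have "?u \<noteq> 0"
    by (rule degenerate_exp_minus_1_nonzero)
  ultimately have "?u dvd fps_X"
    by (simp add: fps_dvd_iff)
  then show ?thesis
    by simp
qed

text \<open>Before composition this is the identity x A(t) t = exp(x t) - 1, checked
  coefficientwise. Substituting \<open>?u\<close> for t respects products because \<open>?u\<close>
  has constant term 0.\<close>

lemma truncated_Bell_gf_1_mult:
  "fps_const x * truncated_Bell_gf 1 l x * (degenerate_exp l 1 - 1)
     = (fps_exp x oo (degenerate_exp l 1 - 1)) - 1"
proof -
  let ?u = "degenerate_exp l 1 - 1" and ?A = "Abs_fps (\<lambda>k. x ^ k / fact (k + 1))"
  have u0: "fps_nth ?u 0 = 0"
    by simp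
  have "fps_const x * ?A * fps_X = fps_exp x - 1"
  proof (rule fps_ext)
    fix k
    show "fps_nth (fps_const x * ?A * fps_X) k = fps_nth (fps_exp x - 1) k"
      by (cases k) (simp_all add: algebra_simps)
  qed
  then have "(fps_const x * ?A * fps_X) oo ?u = (fps_exp x - 1) oo ?u"
    by simp
  then show ?thesis
    by (simp add: truncated_Bell_gf_def fps_compose_mult_distrib[OF u0] fps_compose_sub_distrib)
qed

lemma truncated_Bell_gf_1_eq:
  "fps_const x * truncated_Bell_gf 1 l x =
     fps_shift 1 (fps_exp x oo (degenerate_exp l 1 - 1)) * (fps_X / (degenerate_exp l 1 - 1))"
    (is "?T = fps_shift 1 ?E * ?B")
proof -
  let ?u = "degenerate_exp l 1 - 1"
  \<comment> \<open>The shift loses only the constant term of \<open>?E\<close>, which is 1, the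
    constant term of \<open>fps_exp x\<close>.\<close>
  have "fps_shift 1 ?E * fps_X = ?E - 1"
    by (rule fps_ext) (simp add: fps_X_mult_right_nth)
  then have "?T * ?u = fps_shift 1 ?E * (?B * ?u)"
    unfolding truncated_Bell_gf_1_mult Carlitz_Bernoulli_gf_mult by simp
  then have "?T * ?u = fps_shift 1 ?E * ?B * ?u"
    by (simp only: mult.assoc)
  then show ?thesis
    using mult_right_cancel[OF degenerate_exp_minus_1_nonzero] by blast
qed

lemma truncated_degenerate_Bell_1:
  "x * truncated_degenerate_Bell 1 l n x =
     (\<Sum>m=0..n. 1 / real (m + 1) * real (n choose m) *
        Carlitz_Bernoulli l (n - m) * degenerate_Bell l (m + 1) x)"
proof -
  let ?u = "degenerate_exp l 1 - 1"
  have "x * truncated_degenerate_Bell 1 l n x =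
      fact n * fps_nth (fps_const x * truncated_Bell_gf 1 l x) n"
    by (simp add: truncated_degenerate_Bell_def)
  also have "\<dots> = (\<Sum>m=0..n. fact n * (fps_nth (fps_exp x oo ?u) (m + 1) * fps_nth (fps_X / ?u) (n - m)))"
    unfolding truncated_Bell_gf_1_eq by (simp add: fps_mult_nth sum_distrib_left)
  also have "\<dots> = (\<Sum>m=0..n. 1 / real (m + 1) * real (n choose m) *
        Carlitz_Bernoulli l (n - m) * degenerate_Bell l (m + 1) x)"
  proof (rule sum.cong)
    fix m assume "m \<in> {0..n}"
    then have "m \<le> n"
      by simp
    \<comment> \<open>The shift pairs coefficient m + 1 of the Bell series with index m of the sum.
      The factor 1 / (m + 1) turns its (m + 1)! into the m! that cancels against the binomial
      coefficient.\<close>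
    have "fact (m + 1) = real (m + 1) * fact m"
      by simp
    then show "fact n * (fps_nth (fps_exp x oo ?u) (m + 1) * fps_nth (fps_X / ?u) (n - m)) =
        1 / real (m + 1) * real (n choose m) *
          Carlitz_Bernoulli l (n - m) * degenerate_Bell l (m + 1) x"
      by (simp only: Carlitz_Bernoulli_def degenerate_Bell_def binomial_fact[OF \<open>m \<le> n\<close>])
        (simp add: divide_simps)
  qed simp
  finally show ?thesis .
qed

theorem theorem2:
  fixes l x :: real and n :: nat
  shows "x * truncated_degenerate_Bell 1 l n x =
           (\<Sum>m=0..n. 1 / real (m + 1) * real (n choose m) *
              Carlitz_Bernoulli l (n - m) * degenerate_Bell l (m + 1) x)
       \<and> truncated_degenerate_Bell_number 1 l n =
           (\<Sum>m=0..n. 1 / real (m + 1) * real (n choose m) *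
              Carlitz_Bernoulli l (n - m) * degenerate_Bell_number l (m + 1))"
  using truncated_degenerate_Bell_1[of x l n] truncated_degenerate_Bell_1[of 1 l n]
  unfolding truncated_degenerate_Bell_number_def degenerate_Bell_number_def by simp

end
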